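(* Let $T\subseteq\omega^{<\omega_1}$ be a normal, $\omega$-splitting $\ell_\infty$-tree. If $T$ is Souslin, then $G(\mathcal F^\infty_T)$ is a Fréchet group.
   Context: $\omega^{<\omega_1}$ is the set of functions from countable ordinals to $\omega$. Consider $T\subseteq\omega^{<\omega_1}$ ordered by strict end-extension $\subsetneq$ and closed under restrictions to smaller ordinals, so $T$ is a tree in which the height of $t$ is $\mathrm{ht}(t)=\mathrm{dom}(t)$; $T_\alpha$ is the set of nodes of height $\alpha$ and $T\restriction\delta=\bigcup_{\gamma<\delta}T_\gamma$. $T$ is an $\omega_1$-tree if it has height $\omega_1$ and all levels are countable; it is normal if whenever $s\in T$ and $\mathrm{ht}(s)<\alpha<\omega_1$ there is $t\in T_\alpha$ with $s\subsetneq t$; it is $\omega$-splitting if every node has infinitely many immediate successors; an $\omega_1$-tree is Souslin if it has no uncountable chains and no uncountable antichains. For $f,g\in\omega^{<\omega_1}$ let $\|f\|_\infty=\sup\{f(\gamma):\gamma\in\mathrm{dom}(f)\}$, and let $f-g$ be the function with domain $\mathrm{dom}(f)\cap\mathrm{dom}(g)$ and $(f-g)(\gamma)=|f(\gamma)-g(\gamma)|$. An $\omega_1$-tree $T\subseteq\omega^{<\omega_1}$ is an $\ell_\infty$-tree if $\|s-t\|_\infty<\omega$ for all $s,t\in T$. For $t\in T$ and $n<\omega$ let $F^\infty_n(t)=\{s\in T\restriction\mathrm{ht}(t):\|s-t\|_\infty\le n\}$ and $U^\infty_n(t)=\{a\in[T]^{<\omega}:a\cap F^\infty_n(t)=\emptyset\}$.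 $G(\mathcal F^\infty_T)$ is the group $([T]^{<\omega},\triangle)$ of finite subsets of $T$ with symmetric difference, with the group topology for which $\{U^\infty_n(t):n<\omega,t\in T\}$ is an open neighborhood base at the identity $\emptyset$. A topological group $G$ with identity $e$ is Fréchet if for every $A\subseteq G$ with $e\in\overline A$ there is a sequence in $A$ converging to $e$. *)

theory Defs
  imports
    "HOL-Analysis.Analysis"
    "HOL-Algebra.Group"
    "HOL-Library.Extended_Nat"
    "HOL-Library.Countable_Set_Type"
begin

section \<open>The countable ordinals\<close>

text \<open>The type \<open>omega1\<close> is the well-order \<open>cardSuc natLeq\<close>, that is, the first uncountable
  ordinal. Its elements play the role of the countable ordinals, and \<open>{..<\<alpha>}\<close> is the ordinal
  \<open>\<alpha>\<close> regarded as the set of its predecessors.\<close>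

typedef omega1 = "Field (cardSuc natLeq)"
proof -
  have "(card_of (Field natLeq), card_of (Field (cardSuc natLeq))) \<in> ordLeq"
    by (rule card_of_mono2[OF cardSuc_ordLeq[OF natLeq_Card_order]])
  then have "Field (cardSuc natLeq) \<noteq> {}"
    using card_of_empty3 Field_natLeq by (metis UNIV_not_empty)
  then show ?thesis by blast
qed

instantiation omega1 :: linorder
begin

definition less_eq_omega1 :: "omega1 \<Rightarrow> omega1 \<Rightarrow> bool" where
  "\<alpha> \<le> \<beta> \<longleftrightarrow> (Rep_omega1 \<alpha>, Rep_omega1 \<beta>) \<in> cardSuc natLeq"

definition less_omega1 :: "omega1 \<Rightarrow> omega1 \<Rightarrow> bool" where
  "(\<alpha> :: omega1) < \<beta> \<longleftrightarrow> \<alpha> \<le> \<beta> \<and> \<alpha> \<noteq> \<beta>"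

instance
proof -
  have wo: "Well_order (cardSuc natLeq)"
    using cardSuc_Card_order[OF natLeq_Card_order] card_order_on_def by blast
  then have tr: "trans (cardSuc natLeq)" and an: "antisym (cardSuc natLeq)"
    and rf: "refl_on (Field (cardSuc natLeq)) (cardSuc natLeq)"
    and tot: "Total (cardSuc natLeq)"
    by (auto simp: well_order_on_def linear_order_on_def partial_order_on_def preorder_on_def)
  have le_antisym: "\<alpha> = \<beta>" if "\<alpha> \<le> \<beta>" "\<beta> \<le> \<alpha>" for \<alpha> \<beta> :: omega1
    using that an unfolding less_eq_omega1_def antisym_def by (meson Rep_omega1_inject)
  show "OFCLASS(omega1, linorder_class)"
  proof
    fix \<alpha> \<beta> \<gamma> :: omega1
    show "(\<alpha> < \<beta>) = (\<alpha> \<le> \<beta> \<and> \<not> \<beta> \<le> \<alpha>)"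
      using le_antisym refl_onD[OF rf Rep_omega1]
      unfolding less_omega1_def less_eq_omega1_def by blast
    show "\<alpha> \<le> \<alpha>"
      unfolding less_eq_omega1_def by (rule refl_onD[OF rf Rep_omega1])
    show "\<alpha> \<le> \<gamma>" if "\<alpha> \<le> \<beta>" "\<beta> \<le> \<gamma>"
      using that tr unfolding less_eq_omega1_def trans_def by blast
    show "\<alpha> = \<beta>" if "\<alpha> \<le> \<beta>" "\<beta> \<le> \<alpha>"
      using that by (rule le_antisym)
    show "\<alpha> \<le> \<beta> \<or> \<beta> \<le> \<alpha>"
      using tot Rep_omega1 refl_onD[OF rf Rep_omega1]
      unfolding less_eq_omega1_def total_on_def by metis
  qed
qed

end

instance omega1 :: wellorder
proof
  fix P :: "omega1 \<Rightarrow> bool" and \<alpha>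
  assume step: "\<And>x. (\<And>y. y < x \<Longrightarrow> P y) \<Longrightarrow> P x"
  have "wf (cardSuc natLeq - Id)"
    using cardSuc_Card_order[OF natLeq_Card_order] card_order_on_def well_order_on_def by blast
  then have "wf (inv_image (cardSuc natLeq - Id) Rep_omega1)"
    by (rule wf_inv_image)
  moreover have "inv_image (cardSuc natLeq - Id) Rep_omega1 = {(x, y). x < y}"
    by (auto simp: inv_image_def less_omega1_def less_eq_omega1_def Rep_omega1_inject)
  ultimately have "wf {(x, y :: omega1). x < y}" by simp
  then show "P \<alpha>"
    by (induction rule: wf_induct_rule) (use step in blast)
qed

lemma countable_lessThan_omega1: "countable {..<\<alpha> :: omega1}"
proof -
  let ?r = "cardSuc natLeq"
  have "(card_of (underS ?r (Rep_omega1 \<alpha>)), ?r) \<in> ordLess"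
    using card_of_underS[OF cardSuc_Card_order[OF natLeq_Card_order] Rep_omega1] .
  then have "(card_of (underS ?r (Rep_omega1 \<alpha>)), natLeq) \<in> ordLeq"
    using cardSuc_ordLeq_ordLess natLeq_Card_order card_of_Card_order by blast
  then have "countable (underS ?r (Rep_omega1 \<alpha>))"
    by (simp add: countable_card_le_natLeq)
  moreover have "Rep_omega1 ` {..<\<alpha>} \<subseteq> underS ?r (Rep_omega1 \<alpha>)"
    by (auto simp: underS_def less_omega1_def less_eq_omega1_def Rep_omega1_inject)
  ultimately have "countable (Rep_omega1 ` {..<\<alpha>})"
    by (rule countable_subset[rotated])
  then show ?thesis
    by (rule countable_image_inj_on) (simp add: inj_on_def Rep_omega1_inject)
qed

lemma uncountable_omega1: "uncountable (UNIV :: omega1 set)"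
proof
  assume "countable (UNIV :: omega1 set)"
  then have "countable (Rep_omega1 ` UNIV)" by (rule countable_image)
  then have "countable (Field (cardSuc natLeq))"
    by (simp add: type_definition.Rep_range[OF type_definition_omega1])
  then have "(card_of (Field (cardSuc natLeq)), natLeq) \<in> ordLeq"
    by (simp add: countable_card_le_natLeq)
  then have "(cardSuc natLeq, natLeq) \<in> ordLeq"
    using card_of_Field_ordIso[OF cardSuc_Card_order[OF natLeq_Card_order]]
      ordIso_ordLeq_trans ordIso_symmetric by blast
  then show False
    using cardSuc_greater[OF natLeq_Card_order] not_ordLess_ordLeq by blast
qed


section \<open>Trees of countable sequences of natural numbers\<close>

text \<open>A function from a countable ordinal to \<open>\<omega>\<close> is a partial map whose domain is a proper
  initial segment \<open>{..<\<alpha>}\<close> of \<open>omega1\<close>.\<close>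

type_synonym seq = "omega1 \<rightharpoonup> nat"

definition seqs :: "seq set" where
  "seqs = {t. \<exists>\<alpha>. dom t = {..<\<alpha>}}"

definition ht :: "seq \<Rightarrow> omega1" where
  "ht t = (THE \<alpha>. dom t = {..<\<alpha>})"

definition end_ext :: "seq \<Rightarrow> seq \<Rightarrow> bool" where
  "end_ext s t \<longleftrightarrow> s \<subseteq>\<^sub>m t \<and> s \<noteq> t"

definition seq_tree :: "seq set \<Rightarrow> bool" where
  "seq_tree T \<longleftrightarrow> T \<subseteq> seqs \<and> (\<forall>t\<in>T. \<forall>\<alpha><ht t. t |` {..<\<alpha>} \<in> T)"

definition level :: "seq set \<Rightarrow> omega1 \<Rightarrow> seq set" where
  "level T \<alpha> = {t \<in> T. ht t = \<alpha>}"

definition below :: "seq set \<Rightarrow> omega1 \<Rightarrow> seq set" where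
  "below T \<delta> = (\<Union>\<gamma><\<delta>. level T \<gamma>)"

text \<open>All nodes have countable height, so having height \<open>\<omega>\<^sub>1\<close> means that no level is empty.\<close>

definition omega1_tree :: "seq set \<Rightarrow> bool" where
  "omega1_tree T \<longleftrightarrow> seq_tree T \<and> (\<forall>\<alpha>. level T \<alpha> \<noteq> {} \<and> countable (level T \<alpha>))"

definition normal_tree :: "seq set \<Rightarrow> bool" where
  "normal_tree T \<longleftrightarrow> (\<forall>s\<in>T. \<forall>\<alpha>>ht s. \<exists>t\<in>level T \<alpha>. end_ext s t)"

definition imm_succs :: "seq set \<Rightarrow> seq \<Rightarrow> seq set" where
  "imm_succs T s = {t \<in> T. end_ext s t \<and> \<not> (\<exists>u\<in>T. end_ext s u \<and> end_ext u t)}"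

definition omega_splitting :: "seq set \<Rightarrow> bool" where
  "omega_splitting T \<longleftrightarrow> (\<forall>s\<in>T. infinite (imm_succs T s))"

definition tree_antichain :: "seq set \<Rightarrow> seq set \<Rightarrow> bool" where
  "tree_antichain T A \<longleftrightarrow> A \<subseteq> T \<and> (\<forall>s\<in>A. \<forall>t\<in>A. \<not> end_ext s t)"

definition souslin_tree :: "seq set \<Rightarrow> bool" where
  "souslin_tree T \<longleftrightarrow> omega1_tree T \<and>
     (\<forall>C. pred_on.chain T end_ext C \<longrightarrow> countable C) \<and>
     (\<forall>A. tree_antichain T A \<longrightarrow> countable A)"

definition linf_norm :: "seq \<Rightarrow> enat" where
  "linf_norm f = (SUP \<gamma>\<in>dom f. enat (the (f \<gamma>)))"

text \<open>Subtraction of natural numbers is truncated, so the distance is taken in \<open>int\<close>.\<close>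

definition seq_diff :: "seq \<Rightarrow> seq \<Rightarrow> seq" where
  "seq_diff f g = (\<lambda>\<gamma>. if \<gamma> \<in> dom f \<inter> dom g
     then Some (nat \<bar>int (the (f \<gamma>)) - int (the (g \<gamma>))\<bar>) else None)"

definition linf_tree :: "seq set \<Rightarrow> bool" where
  "linf_tree T \<longleftrightarrow> omega1_tree T \<and> (\<forall>s\<in>T. \<forall>t\<in>T. linf_norm (seq_diff s t) < \<infinity>)"


section \<open>Topological groups\<close>

definition topological_group :: "('a, 'b) monoid_scheme \<Rightarrow> 'a topology \<Rightarrow> bool" where
  "topological_group G X \<longleftrightarrow> Group.group G \<and> topspace X = carrier G \<and>
     continuous_map (prod_topology X X) X (\<lambda>(x, y). x \<otimes>\<^bsub>G\<^esub> y) \<and>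
     continuous_map X X (\<lambda>x. inv\<^bsub>G\<^esub> x)"

definition open_nbhd_base_at :: "'a \<Rightarrow> 'a set set \<Rightarrow> 'a topology \<Rightarrow> bool" where
  "open_nbhd_base_at x B X \<longleftrightarrow>
     (\<forall>U\<in>B. openin X U \<and> x \<in> U) \<and> neighbourhood_base_at x (\<lambda>U. U \<in> B) X"

definition frechet_group :: "('a, 'b) monoid_scheme \<Rightarrow> 'a topology \<Rightarrow> bool" where
  "frechet_group G X \<longleftrightarrow> topological_group G X \<and>
     (\<forall>A \<subseteq> carrier G. \<one>\<^bsub>G\<^esub> \<in> X closure_of A \<longrightarrow>
        (\<exists>a :: nat \<Rightarrow> 'a. range a \<subseteq> A \<and> limitin X a \<one>\<^bsub>G\<^esub> sequentially))"

lemma group_topology_le: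
  assumes X: "topological_group G X" "open_nbhd_base_at \<one>\<^bsub>G\<^esub> B X"
    and Y: "topological_group G Y" "open_nbhd_base_at \<one>\<^bsub>G\<^esub> B Y"
    and W: "openin X W"
  shows "openin Y W"
proof (subst openin_subopen, intro ballI)
  interpret Group.group G using X(1) by (simp add: topological_group_def)
  have tr: "continuous_map Z Z (\<lambda>x. a \<otimes>\<^bsub>G\<^esub> x)"
    if Z: "topological_group G Z" and a: "a \<in> carrier G" for Z a
  proof -
    have "continuous_map Z (prod_topology Z Z) (\<lambda>x. (a, x))"
      using Z a by (auto simp: topological_group_def continuous_map_pairwise o_def)
    from continuous_map_compose[OF this, of Z "\<lambda>(x, y). x \<otimes>\<^bsub>G\<^esub> y"]
    show ?thesis using Z by (simp add: topological_group_def o_def)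
  qed
  fix a assume a: "a \<in> W"
  have ca: "a \<in> carrier G"
    using a openin_subset[OF W] X(1) by (auto simp: topological_group_def)
  have tX: "topspace X = carrier G" and tY: "topspace Y = carrier G"
    using X(1) Y(1) by (auto simp: topological_group_def)
  have "openin X {x \<in> topspace X. a \<otimes>\<^bsub>G\<^esub> x \<in> W}"
    by (rule openin_continuous_map_preimage[OF tr[OF X(1) ca] W])
  moreover have "\<one>\<^bsub>G\<^esub> \<in> {x \<in> topspace X. a \<otimes>\<^bsub>G\<^esub> x \<in> W}"
    using ca a tX by simp
  ultimately obtain U where U: "U \<in> B" "U \<subseteq> {x \<in> topspace X. a \<otimes>\<^bsub>G\<^esub> x \<in> W}"
    using X(2) unfolding open_nbhd_base_at_def neighbourhood_base_at_def by blast
  have "openin Y U" "\<one>\<^bsub>G\<^esub> \<in> U"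
    using U(1) Y(2) unfolding open_nbhd_base_at_def by auto
  then have "openin Y {y \<in> topspace Y. inv\<^bsub>G\<^esub> a \<otimes>\<^bsub>G\<^esub> y \<in> U}"
    using openin_continuous_map_preimage[OF tr[OF Y(1) inv_closed[OF ca]]] by blast
  moreover have "a \<in> {y \<in> topspace Y. inv\<^bsub>G\<^esub> a \<otimes>\<^bsub>G\<^esub> y \<in> U}"
    using ca tY \<open>\<one>\<^bsub>G\<^esub> \<in> U\<close> by simp
  moreover have "{y \<in> topspace Y. inv\<^bsub>G\<^esub> a \<otimes>\<^bsub>G\<^esub> y \<in> U} \<subseteq> W"
  proof
    fix y assume "y \<in> {y \<in> topspace Y. inv\<^bsub>G\<^esub> a \<otimes>\<^bsub>G\<^esub> y \<in> U}"
    then have "y \<in> carrier G" "a \<otimes>\<^bsub>G\<^esub> (inv\<^bsub>G\<^esub> a \<otimes>\<^bsub>G\<^esub> y) \<in> W"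
      using U(2) tY by auto
    then show "y \<in> W" using ca by (simp add: m_assoc[symmetric])
  qed
  ultimately show "\<exists>S. openin Y S \<and> a \<in> S \<and> S \<subseteq> W" by blast
qed


section \<open>The group of finite subsets of a tree\<close>

definition finset_group :: "'a set \<Rightarrow> 'a set monoid" where
  "finset_group T = \<lparr>carrier = {a. finite a \<and> a \<subseteq> T}, mult = sym_diff, one = {}\<rparr>"

definition F_inf :: "seq set \<Rightarrow> nat \<Rightarrow> seq \<Rightarrow> seq set" where
  "F_inf T n t = {s \<in> below T (ht t). linf_norm (seq_diff s t) \<le> enat n}"

definition U_inf :: "seq set \<Rightarrow> nat \<Rightarrow> seq \<Rightarrow> seq set set" where
  "U_inf T n t = {a. finite a \<and> a \<subseteq> T \<and> a \<inter> F_inf T n t = {}}"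

definition is_G_topology :: "seq set \<Rightarrow> seq set topology \<Rightarrow> bool" where
  "is_G_topology T X \<longleftrightarrow> topological_group (finset_group T) X \<and>
     open_nbhd_base_at {} {U_inf T n t | n t. t \<in> T} X"

text \<open>Lemma \<open>ex1_G_topology\<close> below shows that this description determines a unique topology
  for every \<open>\<ell>\<^sub>\<infinity>\<close>-tree.\<close>

definition G_topology :: "seq set \<Rightarrow> seq set topology" where
  "G_topology T = (THE X. is_G_topology T X)"

lemma group_finset_group: "Group.group (finset_group T)"
proof (rule groupI)
  show "\<exists>y\<in>carrier (finset_group T). y \<otimes>\<^bsub>finset_group T\<^esub> x = \<one>\<^bsub>finset_group T\<^esub>"
    if "x \<in> carrier (finset_group T)" for x
    using that by (intro bexI[of _ x]) (auto simp: finset_group_def)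
qed (auto simp: finset_group_def)

lemma inv_finset_group:
  assumes "finite a" and "a \<subseteq> T"
  shows "inv\<^bsub>finset_group T\<^esub> a = a"
  by (rule group.inv_equality[OF group_finset_group]) (use assms in \<open>auto simp: finset_group_def\<close>)

lemma linf_norm_seq_diff_le:
  "linf_norm (seq_diff s t) \<le> enat n \<longleftrightarrow>
     (\<forall>\<gamma> x y. s \<gamma> = Some x \<longrightarrow> t \<gamma> = Some y \<longrightarrow> nat \<bar>int x - int y\<bar> \<le> n)"
  unfolding linf_norm_def SUP_le_iff by (force simp: seq_diff_def dom_def split: if_splits)

lemma dom_eq_lessThan_ht: "t \<in> seqs \<Longrightarrow> dom t = {..<ht t}"
  unfolding seqs_def ht_def by (force intro: theI2 simp: lessThan_eq_iff)

lemma mem_below: "s \<in> below T \<delta> \<longleftrightarrow> s \<in> T \<and> ht s < \<delta>"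
  by (auto simp: below_def level_def)

lemma U_inf_directed:
  assumes T: "linf_tree T" and "t \<in> T" "t' \<in> T"
  shows "\<exists>s\<in>T. \<exists>k. U_inf T k s \<subseteq> U_inf T n t \<inter> U_inf T m t'"
proof -
  have *: "\<exists>k. F_inf T n t \<union> F_inf T m t' \<subseteq> F_inf T k t'"
    if tt: "t \<in> T" "t' \<in> T" "ht t \<le> ht t'" for t t' n m
  proof -
    have "linf_norm (seq_diff t t') < \<infinity>" using T tt by (simp add: linf_tree_def)
    then obtain j where j: "linf_norm (seq_diff t t') \<le> enat j"
      by (metis enat_ord_simps(4) not_infinity_eq order_refl)
    have "F_inf T n t \<subseteq> F_inf T (m + n + j) t'"
    proof
      fix u assume u: "u \<in> F_inf T n t"
      have sub: "T \<subseteq> seqs"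
        using T by (simp add: linf_tree_def omega1_tree_def seq_tree_def)
      have uT: "u \<in> T" "ht u < ht t" and un: "linf_norm (seq_diff u t) \<le> enat n"
        using u by (auto simp: F_inf_def mem_below)
      have "nat \<bar>int x - int y\<bar> \<le> m + n + j" if xy: "u \<gamma> = Some x" "t' \<gamma> = Some y" for \<gamma> x y
      proof -
        have "\<gamma> \<in> dom t"
          using xy(1) uT dom_eq_lessThan_ht[of u] dom_eq_lessThan_ht[of t] sub tt(1)
          by (metis domI lessThan_iff order.strict_trans subsetD)
        then obtain z where z: "t \<gamma> = Some z" by blast
        have "nat \<bar>int x - int z\<bar> \<le> n" "nat \<bar>int z - int y\<bar> \<le> j"
          using un j xy z unfolding linf_norm_seq_diff_le by blast+
        then show ?thesis by linarith
      qed
      then show "u \<in> F_inf T (m + n + j) t'"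
        using uT tt unfolding F_inf_def mem_below linf_norm_seq_diff_le mem_Collect_eq
        by (meson order.strict_trans2)
    qed
    moreover have "F_inf T m t' \<subseteq> F_inf T (m + n + j) t'"
      unfolding F_inf_def by (auto intro: order_trans)
    ultimately show ?thesis by blast
  qed
  have "\<exists>s\<in>T. \<exists>k. F_inf T n t \<union> F_inf T m t' \<subseteq> F_inf T k s"
    using *[of t t' n m] *[of t' t m n] assms(2,3) linear[of "ht t" "ht t'"] by (metis Un_commute)
  then show ?thesis unfolding U_inf_def by blast
qed

lemma ex_G_topology:
  assumes T: "linf_tree T"
  shows "\<exists>X. is_G_topology T X"
proof -
  define sd :: "seq set \<Rightarrow> seq set \<Rightarrow> seq set" where "sd a b = sym_diff a b" for a b
  define C where "C = {a. finite a \<and> a \<subseteq> T}"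
  define P where "P W \<longleftrightarrow> W \<subseteq> C \<and> (\<forall>a\<in>W. \<exists>t\<in>T. \<exists>n. \<forall>u\<in>U_inf T n t. sd a u \<in> W)" for W
  obtain t0 where t0: "t0 \<in> T"
    using T by (auto simp: linf_tree_def omega1_tree_def level_def)
  have U0: "{} \<in> U_inf T n t" for n t by (simp add: U_inf_def)
  have UC: "U_inf T n t \<subseteq> C" for n t by (auto simp: U_inf_def C_def)
  have Usd: "sd u v \<in> U_inf T n t" if "u \<in> U_inf T n t" "v \<in> U_inf T n t" for u v n t
    using that by (auto simp: U_inf_def sd_def)
  have Csd: "sd u v \<in> C" if "u \<in> C" "v \<in> C" for u v
    using that by (auto simp: C_def sd_def)
  have ist: "istopology P"
    unfolding istopology_def
  proof (intro conjI allI impI)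
    fix V W assume V: "P V" and W: "P W"
    show "P (V \<inter> W)"
      unfolding P_def
    proof (intro conjI ballI)
      show "V \<inter> W \<subseteq> C" using V by (auto simp: P_def)
      fix a assume a: "a \<in> V \<inter> W"
      obtain t n where t: "t \<in> T" "\<forall>u\<in>U_inf T n t. sd a u \<in> V"
        using a V unfolding P_def by blast
      obtain t' m where t': "t' \<in> T" "\<forall>u\<in>U_inf T m t'. sd a u \<in> W"
        using a W unfolding P_def by blast
      obtain s k where s: "s \<in> T" "U_inf T k s \<subseteq> U_inf T n t \<inter> U_inf T m t'"
        using U_inf_directed[OF T t(1) t'(1)] by blast
      have "\<forall>u\<in>U_inf T k s. sd a u \<in> V \<inter> W"
      proof
        fix u assume "u \<in> U_inf T k s"
        then have "u \<in> U_inf T n t" "u \<in> U_inf T m t'" using s(2) by auto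
        then show "sd a u \<in> V \<inter> W" using t(2) t'(2) by blast
      qed
      then show "\<exists>t\<in>T. \<exists>n. \<forall>u\<in>U_inf T n t. sd a u \<in> V \<inter> W"
        using s(1) by blast
    qed
  next
    fix K assume "\<forall>W\<in>K. P W"
    then have 1: "\<Union>K \<subseteq> C"
      and 2: "\<And>W a. W \<in> K \<Longrightarrow> a \<in> W \<Longrightarrow> \<exists>t\<in>T. \<exists>n. \<forall>u\<in>U_inf T n t. sd a u \<in> W"
      unfolding P_def by (auto simp del: Un_iff Diff_iff)
    show "P (\<Union>K)"
      unfolding P_def
    proof (intro conjI ballI 1)
      fix a assume "a \<in> \<Union>K"
      then obtain W where W: "W \<in> K" "a \<in> W" by blast
      show "\<exists>t\<in>T. \<exists>n. \<forall>u\<in>U_inf T n t. sd a u \<in> \<Union>K"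
        using 2[OF W] UnionI[OF W(1)] by meson
    qed
  qed
  define X where "X = topology P"
  have op: "openin X W \<longleftrightarrow> P W" for W
    using ist by (simp add: X_def)
  have "P C" using t0 Csd UC unfolding P_def by blast
  then have tsp: "topspace X = C"
    unfolding topspace_def op by (auto simp: P_def)
  have coset: "openin X (sd a ` U_inf T n t)" if a: "a \<in> C" and t: "t \<in> T" for a n t
    unfolding op P_def
  proof (intro conjI ballI)
    show "sd a ` U_inf T n t \<subseteq> C" using a UC Csd by blast
    fix b assume "b \<in> sd a ` U_inf T n t"
    then obtain u where u: "u \<in> U_inf T n t" "b = sd a u" by blast
    have "sd b v \<in> sd a ` U_inf T n t" if v: "v \<in> U_inf T n t" for v
    proof -
      have "sd b v = sd a (sd u v)" using u(2) by (auto simp: sd_def)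
      then show ?thesis using Usd[OF u(1) v] by (rule image_eqI)
    qed
    then show "\<exists>s\<in>T. \<exists>m. \<forall>v\<in>U_inf T m s. sd b v \<in> sd a ` U_inf T n t"
      using t by blast
  qed
  have memco: "a \<in> sd a ` U_inf T n t" for a n t
    by (rule image_eqI[OF _ U0]) (simp add: sd_def)
  have "openin (prod_topology X X) {z \<in> topspace (prod_topology X X). (case z of (x, y) \<Rightarrow> sd x y) \<in> W}"
    if W: "openin X W" for W
  proof (subst openin_subopen, intro ballI)
    fix z assume z: "z \<in> {z \<in> topspace (prod_topology X X). (case z of (x, y) \<Rightarrow> sd x y) \<in> W}"
    obtain a b where zab: "z = (a, b)" by (cases z)
    have ab: "a \<in> C" "b \<in> C" "sd a b \<in> W" using z zab tsp by auto
    obtain t n where t: "t \<in> T" and U: "\<forall>u\<in>U_inf T n t. sd (sd a b) u \<in> W"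
      using ab(3) W unfolding op P_def by meson
    let ?A = "sd a ` U_inf T n t" and ?B = "sd b ` U_inf T n t"
    have "sd (sd a u) (sd b v) \<in> W"
      if uv: "u \<in> U_inf T n t" "v \<in> U_inf T n t" for u v
    proof -
      have "sd (sd a u) (sd b v) = sd (sd a b) (sd u v)" by (auto simp: sd_def)
      then show ?thesis using U Usd[OF uv] by metis
    qed
    moreover have "?A \<subseteq> C" "?B \<subseteq> C" using ab UC Csd by blast+
    ultimately have "?A \<times> ?B \<subseteq>
      {z \<in> topspace (prod_topology X X). (case z of (x, y) \<Rightarrow> sd x y) \<in> W}"
      using tsp by (auto simp: image_iff)
    moreover have "openin (prod_topology X X) (?A \<times> ?B)"
      using coset ab t by (simp add: openin_prod_Times_iff)
    moreover have "z \<in> ?A \<times> ?B" using zab memco by blast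
    ultimately show "\<exists>S. openin (prod_topology X X) S \<and> z \<in> S \<and>
      S \<subseteq> {z \<in> topspace (prod_topology X X). (case z of (x, y) \<Rightarrow> sd x y) \<in> W}" by blast
  qed
  then have "continuous_map (prod_topology X X) X (\<lambda>(x, y). sd x y)"
    unfolding continuous_map_def using Csd tsp by auto
  moreover have "continuous_map X X (\<lambda>x. inv\<^bsub>finset_group T\<^esub> x)"
    by (rule continuous_map_eq[OF continuous_map_id])
      (simp add: tsp C_def inv_finset_group)
  moreover have "(\<lambda>(x, y). x \<otimes>\<^bsub>finset_group T\<^esub> y) = (\<lambda>(x, y). sd x y)"
    by (simp add: finset_group_def sd_def)
  ultimately have "topological_group (finset_group T) X"
    using group_finset_group[of T] tsp
    by (simp add: topological_group_def C_def finset_group_def)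
  moreover have "open_nbhd_base_at {} {U_inf T n t | n t. t \<in> T} X"
  proof -
    have o: "openin X (U_inf T n t)" if "t \<in> T" for n t
      using coset[of "{}" t n] that by (simp add: C_def sd_def)
    have base: "\<exists>n t. t \<in> T \<and> U_inf T n t \<subseteq> W" if W: "openin X W" "{} \<in> W" for W
    proof -
      have [simp]: "sd {} u = u" for u by (simp add: sd_def)
      obtain t n where "t \<in> T" "\<forall>u\<in>U_inf T n t. sd {} u \<in> W"
        using W unfolding op P_def by blast
      then show ?thesis by auto
    qed
    show ?thesis
      unfolding open_nbhd_base_at_def neighbourhood_base_at_def
    proof (intro conjI ballI allI impI)
      fix W assume "openin X W \<and> {} \<in> W"
      then obtain n t where "t \<in> T" "U_inf T n t \<subseteq> W" using base by blast
      then show "\<exists>U V. openin X U \<and> V \<in> {U_inf T n t |n t. t \<in> T} \<and> {} \<in> U \<and> U \<subseteq> V \<and> V \<subseteq> W"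
        using o[of t n] U0[of n t] by (intro exI[of _ "U_inf T n t"]) auto
    qed (use o U0 in auto)
  qed
  ultimately show ?thesis unfolding is_G_topology_def by blast
qed

lemma ex1_G_topology:
  assumes "linf_tree T"
  shows "\<exists>!X. is_G_topology T X"
proof (rule ex_ex1I[OF ex_G_topology[OF assms]])
  fix X Y assume XY: "is_G_topology T X" "is_G_topology T Y"
  have one: "\<one>\<^bsub>finset_group T\<^esub> = {}" by (simp add: finset_group_def)
  show "X = Y"
    unfolding topology_eq
    using XY group_topology_le[where G = "finset_group T", unfolded one]
    unfolding is_G_topology_def by blast
qed

lemma is_G_topology_G_topology: "linf_tree T \<Longrightarrow> is_G_topology T (G_topology T)"
  unfolding G_topology_def by (rule theI'[OF ex1_G_topology])

end

theory Submission
  imports Defs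
begin

text \<open>Call \<open>t\<close> \<open>n\<close>-avoided if some member of \<open>A\<close> consists of nodes of height below
  \<open>ht t\<close> that lie outside \<open>F_inf T n t\<close>. If \<open>{}\<close> is in the closure of \<open>A\<close>, the
  avoided nodes are dense in \<open>T\<close>: given \<open>s\<close>, choose a longer \<open>s'\<close> and a member \<open>a\<close> of
  \<open>A\<close> disjoint from \<open>F_inf T n s'\<close>; a node above \<open>s\<close> whose value at \<open>ht s\<close> is very
  large is far from the nodes of \<open>a\<close> defined at \<open>ht s\<close>, while the other nodes of \<open>a\<close> are
  already far from \<open>s\<close>. Avoidance passes to extensions, so as \<open>T\<close> is Souslin there is one
  level all of whose nodes are \<open>n\<close>-avoided for all \<open>n\<close>. Witnesses for a single node of that
  level converge to \<open>{}\<close>, because any two nodes of \<open>T\<close> have finite distance.\<close>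

section \<open>Countable ordinals: bounds and successors\<close>

text \<open>Otherwise \<open>omega1\<close> would be the union of \<open>S\<close> and the initial
  segments below its members, a countable union of countable sets.\<close>

lemma countable_imp_bounded_omega1:
  fixes S :: "omega1 set"
  assumes "countable S"
  shows "\<exists>\<delta>. \<forall>\<alpha>\<in>S. \<alpha> < \<delta>"
proof (rule ccontr)
  assume "\<nexists>\<delta>. \<forall>\<alpha>\<in>S. \<alpha> < \<delta>"
  then have "(UNIV :: omega1 set) \<subseteq> S \<union> (\<Union>\<alpha>\<in>S. {..<\<alpha>})"
    by (auto simp: not_less) (metis order_antisym)
  moreover have "countable (S \<union> (\<Union>\<alpha>\<in>S. {..<\<alpha>}))"
    using assms countable_lessThan_omega1 by auto
  ultimately show False
    using uncountable_omega1 countable_subset by blast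
qed

lemma ex_succ_omega1: "\<exists>\<beta> :: omega1. {..<\<beta>} = {..\<alpha>}"
proof -
  have "\<exists>\<beta>. \<alpha> < \<beta>"
    using countable_imp_bounded_omega1[of "{\<alpha>}"] by auto
  then have "\<alpha> < (LEAST \<beta>. \<alpha> < \<beta>)"
    by (rule LeastI_ex)
  then have "{..<LEAST \<beta>. \<alpha> < \<beta>} = {..\<alpha>}"
    by (auto dest: not_less_Least simp: not_less)
  then show ?thesis ..
qed

section \<open>Heights and comparability of nodes\<close>

lemma ht_eqI: "dom t = {..<\<alpha>} \<Longrightarrow> ht t = \<alpha>"
  unfolding ht_def by (auto simp: lessThan_eq_iff)

lemma ht_mono:
  assumes "s \<in> seqs" "t \<in> seqs" "s \<subseteq>\<^sub>m t"
  shows "ht s \<le> ht t"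
  using map_le_implies_dom_le[OF assms(3)] dom_eq_lessThan_ht[OF assms(1)]
    dom_eq_lessThan_ht[OF assms(2)] by simp

lemma dom_subset_of_ht_le:
  "s \<in> seqs \<Longrightarrow> t \<in> seqs \<Longrightarrow> ht s \<le> ht t \<Longrightarrow> dom s \<subseteq> dom t"
  by (simp add: dom_eq_lessThan_ht)

lemma map_le_of_common_ext:
  assumes "s \<in> seqs" "t \<in> seqs" "s \<subseteq>\<^sub>m d" "t \<subseteq>\<^sub>m d" "ht s \<le> ht t"
  shows "s \<subseteq>\<^sub>m t"
proof -
  have "dom s \<subseteq> dom t"
    using assms by (simp add: dom_subset_of_ht_le)
  then show ?thesis
    using assms(3,4) unfolding map_le_def by (metis subsetD)
qed

section \<open>Immediate successors\<close>

text \<open>If \<open>ht v\<close> lay beyond the successor \<beta> of \<open>ht s\<close>,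
  restricting \<open>v\<close> to \<beta> would give a node of \<open>T\<close> strictly between
  \<open>s\<close> and \<open>v\<close>.\<close>

lemma imm_succs_ht:
  assumes T: "seq_tree T" and s: "s \<in> T" and v: "v \<in> imm_succs T s"
  shows "{..<ht v} = {..ht s}"
proof -
  obtain \<beta> where \<beta>: "{..<\<beta>} = {..ht s}"
    using ex_succ_omega1 by blast
  have sq: "T \<subseteq> seqs" using T by (simp add: seq_tree_def)
  have vT: "v \<in> T" and ext: "end_ext s v"
    and imm: "\<And>u. u \<in> T \<Longrightarrow> end_ext s u \<Longrightarrow> \<not> end_ext u v"
    using v by (auto simp: imm_succs_def)
  have ds: "dom s = {..<ht s}" and dv: "dom v = {..<ht v}"
    using sq s vT by (metis subsetD dom_eq_lessThan_ht)+
  have sv: "s \<subseteq>\<^sub>m v" "s \<noteq> v" using ext by (auto simp: end_ext_def)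
  have "ht s \<noteq> ht v"
  proof
    assume "ht s = ht v"
    then have "v \<subseteq>\<^sub>m s"
      using map_le_of_common_ext[of v s v] sq s vT sv by auto
    then show False using sv map_le_antisym by blast
  qed
  then have lt: "ht s < ht v"
    using ht_mono[OF subsetD[OF sq s] subsetD[OF sq vT] sv(1)] by simp
  have \<beta>v: "\<beta> \<le> ht v"
    using lt \<beta> by (metis atMost_iff lessThan_iff not_less)
  have "ht s < \<beta>" using \<beta> by auto
  have "\<not> \<beta> < ht v"
  proof
    assume less: "\<beta> < ht v"
    let ?u = "v |` {..<\<beta>}"
    have "dom ?u = {..<\<beta>}" using dv less by auto
    then have hu: "ht ?u = \<beta>" by (rule ht_eqI)
    have "?u \<in> T" using T vT less by (auto simp: seq_tree_def)
    moreover have "s \<subseteq>\<^sub>m ?u"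
      using sv(1) ds \<open>ht s < \<beta>\<close> by (auto simp: map_le_def restrict_map_def)
    moreover have "?u \<subseteq>\<^sub>m v" by (auto simp: map_le_def)
    moreover have "s \<noteq> ?u" "?u \<noteq> v"
      using hu less \<open>ht s < \<beta>\<close> by (metis less_irrefl)+
    ultimately show False
      using imm[of ?u] by (auto simp: end_ext_def)
  qed
  then show ?thesis using \<beta>v \<beta> by simp
qed

text \<open>Immediate successors of \<open>s\<close> agree below \<open>ht s\<close> and have their
  last entry there, so that entry determines them; infinitely many of them cannot all have it
  bounded by \<open>N\<close>.\<close>

lemma imm_succs_value_unbounded:
  assumes T: "seq_tree T" and s: "s \<in> T" and inf: "infinite (imm_succs T s)"
  shows "\<exists>v\<in>imm_succs T s. \<exists>x>N. v (ht s) = Some x"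
proof -
  have dv: "dom v = {..ht s}" if "v \<in> imm_succs T s" for v
    using imm_succs_ht[OF T s that] dom_eq_lessThan_ht[of v] that T
    by (auto simp: imm_succs_def seq_tree_def)
  have ds: "dom s = {..<ht s}"
    using T s unfolding seq_tree_def by (metis subsetD dom_eq_lessThan_ht)
  have sv: "s \<subseteq>\<^sub>m v" if "v \<in> imm_succs T s" for v
    using that by (auto simp: imm_succs_def end_ext_def)
  have "inj_on (\<lambda>v. v (ht s)) (imm_succs T s)"
  proof (rule inj_onI)
    fix v w assume v: "v \<in> imm_succs T s" and w: "w \<in> imm_succs T s"
      and eq: "v (ht s) = w (ht s)"
    show "v = w"
    proof
      fix \<gamma>
      consider "\<gamma> < ht s" | "\<gamma> = ht s" | "ht s < \<gamma>" by (rule linorder_cases)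
      then show "v \<gamma> = w \<gamma>"
      proof cases
        case 1
        then have "\<gamma> \<in> dom s" using ds by simp
        then show ?thesis using sv[OF v] sv[OF w] unfolding map_le_def by metis
      next
        case 3
        then have "\<gamma> \<notin> dom v" "\<gamma> \<notin> dom w" using dv[OF v] dv[OF w] by auto
        then show ?thesis by (simp add: domIff)
      qed (use eq in simp)
    qed
  qed
  then have "infinite ((\<lambda>v. v (ht s)) ` imm_succs T s)"
    using inf finite_imageD by blast
  then have "\<not> (\<lambda>v. v (ht s)) ` imm_succs T s \<subseteq> Some ` {..N}"
    by (meson finite_atMost finite_imageI finite_subset)
  then obtain v where v: "v \<in> imm_succs T s" "v (ht s) \<notin> Some ` {..N}" by blast
  have "ht s \<in> dom v" using dv[OF v(1)] by simp
  then obtain x where "v (ht s) = Some x" by blast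
  then show ?thesis using v by (intro bexI[of _ v] exI[of _ x]) auto
qed

lemma normal_tree_ext:
  assumes "normal_tree T" "s \<in> T" "ht s < \<alpha>"
  obtains t where "t \<in> T" "ht t = \<alpha>" "s \<subseteq>\<^sub>m t"
proof -
  have "\<exists>t\<in>level T \<alpha>. end_ext s t"
    using assms by (simp add: normal_tree_def)
  then show thesis
    using that by (auto simp: level_def end_ext_def)
qed

section \<open>Estimates for the sup distance\<close>

lemma linf_norm_seq_diff_mono:
  assumes "t \<subseteq>\<^sub>m t'" "linf_norm (seq_diff u t') \<le> enat n"
  shows "linf_norm (seq_diff u t) \<le> enat n"
  using assms unfolding linf_norm_seq_diff_le map_le_def by (metis domI)

text \<open>Distances only see common domains, so \<open>t\<close> controls \<open>u\<close> and
  \<open>v\<close> only where it is defined; hence the condition on \<open>dom u\<close>.\<close>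

lemma linf_norm_seq_diff_triangle:
  assumes "dom u \<subseteq> dom t" "linf_norm (seq_diff u t) \<le> enat n"
    and "linf_norm (seq_diff t v) \<le> enat m"
  shows "linf_norm (seq_diff u v) \<le> enat (n + m)"
  unfolding linf_norm_seq_diff_le
proof (intro allI impI)
  fix \<gamma> x y assume xy: "u \<gamma> = Some x" "v \<gamma> = Some y"
  then obtain z where z: "t \<gamma> = Some z" using assms(1) by blast
  have "nat \<bar>int x - int z\<bar> \<le> n" "nat \<bar>int z - int y\<bar> \<le> m"
    using assms(2,3) xy z unfolding linf_norm_seq_diff_le by blast+
  then show "nat \<bar>int x - int y\<bar> \<le> n + m" by linarith
qed

section \<open>Avoided nodes: openness and density\<close>

text \<open>\<open>F_inf T n t\<close> has only nodes of height below \<open>ht t\<close>, so a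
  taller node of \<open>a\<close> would miss it merely by its height and might be caught at an
  extension of \<open>t\<close>. The bound on \<open>a\<close> excludes this.\<close>

definition avoided :: "seq set \<Rightarrow> seq set set \<Rightarrow> nat \<Rightarrow> seq set" where
  "avoided T A n = {t \<in> T. \<exists>a\<in>A. a \<subseteq> below T (ht t) \<and> a \<inter> F_inf T n t = {}}"

lemma avoided_upward_closed:
  assumes "T \<subseteq> seqs" "t \<in> avoided T A n" "t' \<in> T" "t \<subseteq>\<^sub>m t'"
  shows "t' \<in> avoided T A n"
proof -
  obtain a where a: "a \<in> A" "a \<subseteq> below T (ht t)" "a \<inter> F_inf T n t = {}" and t: "t \<in> T"
    using assms(2) by (auto simp: avoided_def)
  have "ht t \<le> ht t'" using ht_mono assms t by blast
  then have "a \<subseteq> below T (ht t')" using a(2) by (force simp: mem_below)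
  moreover have "a \<inter> F_inf T n t' = {}"
    using a(2,3) linf_norm_seq_diff_mono[OF assms(4)] by (auto simp: F_inf_def)
  ultimately show ?thesis using a(1) assms(3) by (auto simp: avoided_def)
qed

lemma avoided_dense:
  assumes T: "seq_tree T" and N: "normal_tree T" and S: "omega_splitting T"
    and A: "\<And>t n. t \<in> T \<Longrightarrow> \<exists>a\<in>A. a \<in> U_inf T n t"
    and s: "s \<in> T"
  shows "\<exists>t\<in>avoided T A n. s \<subseteq>\<^sub>m t"
proof -
  have sq: "T \<subseteq> seqs" using T by (simp add: seq_tree_def)
  \<comment> \<open>A strictly longer \<open>s'\<close> is taken so that \<open>F_inf T n s'\<close>
    also tests nodes of height exactly \<open>ht s\<close>.\<close>
  obtain \<beta> where "ht s < \<beta>"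
    using countable_imp_bounded_omega1[of "{ht s}"] by auto
  then obtain s' where s': "s' \<in> T" "ht s' = \<beta>" "s \<subseteq>\<^sub>m s'"
    using normal_tree_ext[OF N s] by blast
  obtain a where a: "a \<in> A" "finite a" "a \<subseteq> T" "a \<inter> F_inf T n s' = {}"
    using A[OF s'(1), of n] by (auto simp: U_inf_def)
  \<comment> \<open>For \<open>u\<close> undefined at \<open>ht s\<close> the value is arbitrary and
    can only enlarge \<open>M\<close>; \<open>0\<close> covers empty \<open>a\<close>.\<close>
  define M where "M = Max (insert 0 ((\<lambda>u. the (u (ht s))) ` a))"
  have M: "the (u (ht s)) \<le> M" if "u \<in> a" for u
    unfolding M_def using that a(2) by (intro Max_ge) auto
  obtain v x where v: "v \<in> imm_succs T s" "v (ht s) = Some x" "x > M + n"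
    using imm_succs_value_unbounded[OF T s, of "M + n"] S s
    by (auto simp: omega_splitting_def)
  have vT: "v \<in> T" "s \<subseteq>\<^sub>m v" using v by (auto simp: imm_succs_def end_ext_def)
  \<comment> \<open>At height \<delta> a node can extend \<open>v\<close> and have all of
    \<open>a\<close> below its level.\<close>
  obtain \<delta> where \<delta>: "\<forall>\<alpha>\<in>insert (ht v) (ht ` a). \<alpha> < \<delta>"
    using countable_imp_bounded_omega1[of "insert (ht v) (ht ` a)"] a(2)
    by (auto simp: countable_finite)
  then have "ht v < \<delta>" by simp
  then obtain t where t: "t \<in> T" "ht t = \<delta>" "v \<subseteq>\<^sub>m t"
    using normal_tree_ext[OF N vT(1)] by blast
  have st: "s \<subseteq>\<^sub>m t" using vT(2) t(3) map_le_trans by blast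
  have "\<not> linf_norm (seq_diff u t) \<le> enat n" if u: "u \<in> a" for u
  proof
    assume le: "linf_norm (seq_diff u t) \<le> enat n"
    have du: "dom u = {..<ht u}" using sq a(3) u by (metis subsetD dom_eq_lessThan_ht)
    show False
    proof (cases "ht s < ht u")
      case True
      then have "ht s \<in> dom u" using du by simp
      then obtain y where y: "u (ht s) = Some y" by blast
      have "t (ht s) = Some x" using t(3) v(2) by (metis domI map_le_def)
      then have "nat \<bar>int y - int x\<bar> \<le> n"
        using le y unfolding linf_norm_seq_diff_le by blast
      moreover have "y \<le> M" using M[OF u] y by simp
      ultimately show False using v(3) by linarith
    next
      \<comment> \<open>Here \<open>u\<close> lives inside \<open>dom s\<close>, where
        \<open>t\<close> and \<open>s'\<close> coincide, so being close to \<open>t\<close> would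
        put \<open>u\<close> into \<open>F_inf T n s'\<close>.\<close>
      case False
      then have "dom u \<subseteq> dom s"
        using sq s a(3) u by (intro dom_subset_of_ht_le) auto
      moreover have "linf_norm (seq_diff u s) \<le> enat n"
        using linf_norm_seq_diff_mono[OF st le] .
      moreover have "linf_norm (seq_diff s s') \<le> enat 0"
        using s'(3) unfolding linf_norm_seq_diff_le map_le_def
        by (metis abs_zero cancel_comm_monoid_add_class.diff_cancel domI le_refl nat_0 option.inject)
      ultimately have "linf_norm (seq_diff u s') \<le> enat n"
        using linf_norm_seq_diff_triangle[of u s n s' 0] by simp
      moreover have "ht u < ht s'" using False \<open>ht s < \<beta>\<close> s'(2) by simp
      ultimately show False using a(3,4) u by (auto simp: F_inf_def mem_below)
    qed
  qed
  then have "a \<inter> F_inf T n t = {}" by (auto simp: F_inf_def)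
  moreover have "a \<subseteq> below T (ht t)" using a(3) \<delta> t(2) by (auto simp: mem_below)
  ultimately show ?thesis using a(1) t(1) st by (auto simp: avoided_def)
qed

section \<open>Open dense sets in Souslin trees\<close>

text \<open>The minimal nodes of an open dense set form an antichain, so Souslinity bounds their
  heights.\<close>

lemma souslin_open_dense_contains_levels:
  assumes T: "souslin_tree T" and D: "D \<subseteq> T"
    and up: "\<And>t t'. t \<in> D \<Longrightarrow> t' \<in> T \<Longrightarrow> t \<subseteq>\<^sub>m t' \<Longrightarrow> t' \<in> D"
    and dense: "\<And>s. s \<in> T \<Longrightarrow> \<exists>t\<in>D. s \<subseteq>\<^sub>m t"
  shows "\<exists>\<delta>. \<forall>t\<in>T. \<delta> \<le> ht t \<longrightarrow> t \<in> D"
proof -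
  have sq: "T \<subseteq> seqs"
    using T by (simp add: souslin_tree_def omega1_tree_def seq_tree_def)
  define M where "M = {t \<in> D. \<forall>s\<in>D. \<not> end_ext s t}"
  have "tree_antichain T M" using D by (auto simp: tree_antichain_def M_def)
  then have "countable M" using T by (simp add: souslin_tree_def)
  then obtain \<delta> where \<delta>: "\<forall>\<alpha>\<in>ht ` M. \<alpha> < \<delta>"
    using countable_imp_bounded_omega1[of "ht ` M"] by auto
  have "t \<in> D" if t: "t \<in> T" "\<delta> \<le> ht t" for t
  proof -
    obtain d where d: "d \<in> D" "t \<subseteq>\<^sub>m d" using dense t by blast
    \<comment> \<open>Heights are well-ordered, so some member of \<open>D\<close> below
      \<open>d\<close> has least height; it is minimal in \<open>D\<close>.\<close>
    obtain m where m: "m \<in> D" "m \<subseteq>\<^sub>m d"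
      and least: "\<And>s. s \<in> D \<Longrightarrow> s \<subseteq>\<^sub>m d \<Longrightarrow> ht m \<le> ht s"
      using exists_least_iff[of "\<lambda>\<alpha>. \<exists>m\<in>D. m \<subseteq>\<^sub>m d \<and> ht m = \<alpha>"] d(1)
      by (metis linorder_not_le map_le_refl)
    have "m \<in> M"
      unfolding M_def
    proof (intro CollectI conjI ballI notI m(1))
      fix s assume s: "s \<in> D" "end_ext s m"
      have sm: "s \<subseteq>\<^sub>m m" "s \<noteq> m" using s(2) by (auto simp: end_ext_def)
      have "ht m \<le> ht s" using least s(1) sm(1) m(2) map_le_trans by blast
      then have "m \<subseteq>\<^sub>m s"
        using map_le_of_common_ext[of m s m] sm m(1) s(1) D sq by auto
      then show False using sm map_le_antisym by blast
    qed
    then have "ht m \<le> ht t" using \<delta> t(2) by force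
    \<comment> \<open>Both \<open>m\<close> and \<open>t\<close> lie below \<open>d\<close>, so
      comparing heights suffices.\<close>
    then have "m \<subseteq>\<^sub>m t"
      using map_le_of_common_ext[of m t d] m d t D sq by auto
    then show "t \<in> D" using up m(1) t(1) by blast
  qed
  then show ?thesis by blast
qed

section \<open>Construction of the convergent sequence\<close>

theorem theorem6p11:
  fixes T :: "seq set"
  assumes "linf_tree T" and "normal_tree T" and "omega_splitting T"
    and "souslin_tree T"
  shows "frechet_group (finset_group T) (G_topology T)"
proof -
  let ?X = "G_topology T"
  have top: "topological_group (finset_group T) ?X"
    and base: "open_nbhd_base_at {} {U_inf T n t | n t. t \<in> T} ?X"
    using is_G_topology_G_topology[OF assms(1)] by (auto simp: is_G_topology_def)
  have one: "\<one>\<^bsub>finset_group T\<^esub> = {}" by (simp add: finset_group_def)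
  have ts: "topspace ?X = {a. finite a \<and> a \<subseteq> T}"
    using top by (simp add: topological_group_def finset_group_def)
  have tree: "seq_tree T" and sq: "T \<subseteq> seqs"
    using assms(1) by (auto simp: linf_tree_def omega1_tree_def seq_tree_def)
  have "\<exists>a. range a \<subseteq> A \<and> limitin ?X a {} sequentially"
    if A: "A \<subseteq> carrier (finset_group T)" and cl: "{} \<in> ?X closure_of A" for A
  proof -
    have hit: "\<exists>a\<in>A. a \<in> U_inf T n t" if "t \<in> T" for t n
    proof -
      have "openin ?X (U_inf T n t)" "{} \<in> U_inf T n t"
        using base that by (auto simp: open_nbhd_base_at_def)
      then show ?thesis using cl unfolding in_closure_of by blast
    qed
    have "\<exists>\<delta>. \<forall>t\<in>T. \<delta> \<le> ht t \<longrightarrow> t \<in> avoided T A n" for n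
    proof (rule souslin_open_dense_contains_levels[OF assms(4)])
      show "avoided T A n \<subseteq> T" by (auto simp: avoided_def)
    qed (use avoided_upward_closed[OF sq] avoided_dense[OF tree assms(2,3) hit] in blast)+
    then obtain \<delta> where \<delta>: "\<And>n t. t \<in> T \<Longrightarrow> \<delta> n \<le> ht t \<Longrightarrow> t \<in> avoided T A n"
      by metis
    \<comment> \<open>Countably many bounds \<open>\<delta> n\<close> have a common strict upper
      bound, so one node \<open>p\<close> serves every \<open>n\<close>.\<close>
    obtain \<epsilon> where \<epsilon>: "\<And>n :: nat. \<delta> n < \<epsilon>"
      using countable_imp_bounded_omega1[of "range \<delta>"] by auto
    obtain p where p: "p \<in> T" "ht p = \<epsilon>"
      using assms(1) unfolding linf_tree_def omega1_tree_def level_def by fast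
    then have "\<exists>a\<in>A. a \<subseteq> below T \<epsilon> \<and> a \<inter> F_inf T n p = {}" for n
      using \<delta>[of p n] \<epsilon>[of n] by (auto simp: avoided_def)
    then obtain a where a: "\<And>n. a n \<in> A" "\<And>n. a n \<subseteq> below T \<epsilon>"
      "\<And>n. a n \<inter> F_inf T n p = {}"
      by metis
    have "limitin ?X a {} sequentially"
      unfolding limitin_def
    proof (intro conjI allI impI)
      show "{} \<in> topspace ?X" by (simp add: ts)
      fix W assume W: "openin ?X W \<and> {} \<in> W"
      have "neighbourhood_base_at {} (\<lambda>U. U \<in> {U_inf T n t | n t. t \<in> T}) ?X"
        using base by (simp add: open_nbhd_base_at_def)
      then obtain V where "V \<in> {U_inf T n t | n t. t \<in> T}" "V \<subseteq> W"
        using W unfolding neighbourhood_base_at_def by meson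
      then obtain n t where t: "t \<in> T" "U_inf T n t \<subseteq> W" by blast
      have "linf_norm (seq_diff t p) < \<infinity>"
        using assms(1) t(1) p(1) by (simp add: linf_tree_def)
      then obtain j where j: "linf_norm (seq_diff t p) \<le> enat j"
        by (metis enat_ord_simps(4) not_infinity_eq order_refl)
      \<comment> \<open>A node of \<open>a k\<close> within \<open>n\<close> of \<open>t\<close>
        would be within \<open>n + j\<close> of \<open>p\<close>, hence in
        \<open>F_inf T k p\<close>, which \<open>a k\<close> misses.\<close>
      have "a k \<in> W" if k: "n + j \<le> k" for k
      proof -
        have "u \<notin> F_inf T n t" if u: "u \<in> a k" for u
        proof
          assume F: "u \<in> F_inf T n t"
          then have "u \<in> T" "ht u < ht t" by (auto simp: F_inf_def mem_below)
          then have "dom u \<subseteq> dom t"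
            using sq t(1) by (intro dom_subset_of_ht_le) auto
          then have "linf_norm (seq_diff u p) \<le> enat (n + j)"
            using linf_norm_seq_diff_triangle[of u t n p j] F j by (auto simp: F_inf_def)
          then have "linf_norm (seq_diff u p) \<le> enat k"
            using k by (meson enat_ord_simps(1) order_trans)
          then have "u \<in> F_inf T k p" using a(2) u p(2) by (auto simp: F_inf_def)
          then show False using a(3) u by blast
        qed
        moreover have "finite (a k)" "a k \<subseteq> T"
          using a(1)[of k] A by (auto simp: finset_group_def)
        ultimately have "a k \<in> U_inf T n t" by (auto simp: U_inf_def)
        then show ?thesis using t(2) by blast
      qed
      then show "\<forall>\<^sub>F k in sequentially. a k \<in> W"
        unfolding eventually_sequentially by blast
    qed
    then show ?thesis using a(1) by blast
  qed
  then show ?thesis using top by (simp add: frechet_group_def one)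
qed

end
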